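(* Let $R$ be a commutative ring with nonzero identity. The following statements are equivalent. (1) $GD(R)$ is a nested space. (2) The poset $\mathcal R_{\mathrm{pr}}(R)=\{\sqrt{aR}:a\in R^\#\}$ is linearly ordered by inclusion. (3) The radical ideals of $R$ are linearly ordered by inclusion. (4) The prime ideals of $R$ are linearly ordered by inclusion. (5) Every proper ideal of $R$ is quasi-primary. (6) The Zariski topology on $\operatorname{Spec}(R)$ is nested.
   Context: For a commutative ring $R$ with nonzero identity and unit group $U(R)$, let $R^\#=R\setminus(U(R)\cup\{0\})$ be the set of nonzero nonunits. For $a,b\in R^\#$ write $a\sim b$ if $aR=bR$; $[a]$ denotes the equivalence class of $a$ and $EC(R^\#)$ the set of equivalence classes. For $a\in R^\#$ put $B_a=\{[b]\in EC(R^\#): b\mid a^n\text{ for some }n\geq 1\}$. The sets $B_a$ ($a\in R^\#$) form a basis of a topology on $EC(R^\#)$; the resulting space is denoted $GD(R)$ (the generalized divisor topology). A topological space is nested if its open sets are linearly ordered by inclusion. A proper ideal $I$ of $R$ is quasi-primary if $\sqrt I$ is a prime ideal. *)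

theory Defs
  imports "HOL-Algebra.Ring_Divisibility" "HOL-Analysis.Abstract_Topology"
begin

section \<open>The generalized divisor topology\<close>

definition nonzero_nonunits :: "('a, 'b) ring_scheme \<Rightarrow> 'a set" where
  "nonzero_nonunits R = carrier R - (Units R \<union> {\<zero>\<^bsub>R\<^esub>})"

definition same_principal :: "('a, 'b) ring_scheme \<Rightarrow> ('a \<times> 'a) set" where
  "same_principal R =
     {(a, b) \<in> nonzero_nonunits R \<times> nonzero_nonunits R. PIdl\<^bsub>R\<^esub> a = PIdl\<^bsub>R\<^esub> b}"

definition EC :: "('a, 'b) ring_scheme \<Rightarrow> 'a set set" where
  "EC R = nonzero_nonunits R // same_principal R"

definition gd_basic :: "('a, 'b) ring_scheme \<Rightarrow> 'a \<Rightarrow> 'a set set" where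
  "gd_basic R a =
     {same_principal R `` {b} | b. b \<in> nonzero_nonunits R \<and>
        (\<exists>n::nat. n \<ge> 1 \<and> b divides\<^bsub>R\<^esub> (a [^]\<^bsub>R\<^esub> n))}"

definition GD :: "('a, 'b) ring_scheme \<Rightarrow> 'a set topology" where
  "GD R = topology (arbitrary union_of (\<lambda>B. B \<in> gd_basic R ` nonzero_nonunits R))"

definition nested_space :: "'a topology \<Rightarrow> bool" where
  "nested_space X \<longleftrightarrow> chain\<^sub>\<subseteq> {U. openin X U}"


section \<open>Radicals, quasi-primary ideals and the prime spectrum\<close>

definition ideal_radical :: "('a, 'b) ring_scheme \<Rightarrow> 'a set \<Rightarrow> 'a set" where
  "ideal_radical R I = {x \<in> carrier R. \<exists>n::nat. n \<ge> 1 \<and> x [^]\<^bsub>R\<^esub> n \<in> I}"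

text \<open>The unit ideal counts as a radical ideal. Being the largest ideal, it does not affect
  whether the radical ideals form a chain.\<close>

definition radical_ideal :: "'a set \<Rightarrow> ('a, 'b) ring_scheme \<Rightarrow> bool" where
  "radical_ideal I R \<longleftrightarrow> ideal I R \<and> ideal_radical R I = I"

definition quasi_primary :: "'a set \<Rightarrow> ('a, 'b) ring_scheme \<Rightarrow> bool" where
  "quasi_primary I R \<longleftrightarrow>
     ideal I R \<and> I \<noteq> carrier R \<and> primeideal (ideal_radical R I) R"

definition principal_radicals :: "('a, 'b) ring_scheme \<Rightarrow> 'a set set" where
  "principal_radicals R = {ideal_radical R (PIdl\<^bsub>R\<^esub> a) | a. a \<in> nonzero_nonunits R}"

definition Spec :: "('a, 'b) ring_scheme \<Rightarrow> 'a set set" where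
  "Spec R = {P. primeideal P R}"

definition zariski_closed :: "('a, 'b) ring_scheme \<Rightarrow> 'a set \<Rightarrow> 'a set set" where
  "zariski_closed R I = {P \<in> Spec R. I \<subseteq> P}"

definition zariski :: "('a, 'b) ring_scheme \<Rightarrow> 'a set topology" where
  "zariski R = topology (\<lambda>U. \<exists>I. ideal I R \<and> U = Spec R - zariski_closed R I)"


section \<open>The two families of open sets are topologies\<close>

context cring
begin

lemma equiv_same_principal: "equiv (nonzero_nonunits R) (same_principal R)"
  by (auto simp: equiv_def refl_on_def sym_def trans_def same_principal_def)

lemma same_principal_class_eq:
  assumes "b \<in> nonzero_nonunits R" "c \<in> nonzero_nonunits R"
    and "same_principal R `` {b} = same_principal R `` {c}"
  shows "PIdl b = PIdl c"
  using eq_equiv_class[OF assms(3) equiv_same_principal assms(2)]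
  by (auto simp: same_principal_def)

lemma same_principal_divides:
  assumes "b \<in> nonzero_nonunits R" "c \<in> nonzero_nonunits R"
    and "same_principal R `` {b} = same_principal R `` {c}"
  shows "b divides c"
proof -
  have "b \<in> carrier R" "c \<in> carrier R"
    using assms by (auto simp: nonzero_nonunits_def)
  then show ?thesis
    using same_principal_class_eq[OF assms] to_contain_is_to_divide by (metis order_refl)
qed

text \<open>Membership of a class in a basic set does not depend on its representative.\<close>

lemma class_in_gd_basic_iff:
  assumes "b \<in> nonzero_nonunits R"
  shows "same_principal R `` {b} \<in> gd_basic R a \<longleftrightarrow>
    (\<exists>n::nat. n \<ge> 1 \<and> b divides (a [^] n))"
proof
  assume "same_principal R `` {b} \<in> gd_basic R a"
  then obtain c n where c: "c \<in> nonzero_nonunits R" "n \<ge> (1::nat)" "c divides (a [^] n)"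
    "same_principal R `` {b} = same_principal R `` {c}"
    by (auto simp: gd_basic_def)
  have "b divides c"
    using same_principal_divides assms c by blast
  then have "b divides (a [^] n)"
    using c assms by (auto simp: nonzero_nonunits_def intro: divides_trans)
  with c show "\<exists>n::nat. n \<ge> 1 \<and> b divides (a [^] n)" by blast
qed (use assms in \<open>auto simp: gd_basic_def\<close>)

lemma divides_pow:
  assumes "a divides b" "a \<in> carrier R" "b \<in> carrier R"
  shows "(a [^] (n::nat)) divides (b [^] n)"
proof -
  obtain c where "c \<in> carrier R" "b = a \<otimes> c"
    using assms by (auto simp: factor_def)
  then have "b [^] n = a [^] n \<otimes> c [^] n" "c [^] n \<in> carrier R"
    using assms by (simp_all add: nat_pow_distrib)
  then show ?thesis by (auto simp: factor_def)
qed

lemma gd_basic_mono: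
  assumes a: "a \<in> nonzero_nonunits R" and c: "c \<in> nonzero_nonunits R"
    and "same_principal R `` {c} \<in> gd_basic R a"
  shows "gd_basic R c \<subseteq> gd_basic R a"
proof
  fix x assume "x \<in> gd_basic R c"
  then obtain b m where b: "b \<in> nonzero_nonunits R" "m \<ge> (1::nat)" "b divides (c [^] m)"
    "x = same_principal R `` {b}"
    by (auto simp: gd_basic_def)
  obtain n where n: "n \<ge> (1::nat)" "c divides (a [^] n)"
    using assms(3) c class_in_gd_basic_iff by blast
  have carr: "a \<in> carrier R" "b \<in> carrier R" "c \<in> carrier R"
    using a b c by (auto simp: nonzero_nonunits_def)
  have "(c [^] m) divides ((a [^] n) [^] m)"
    using divides_pow n carr by simp
  then have "b divides (a [^] (n * m))"
    using b(3) carr by (auto simp: nat_pow_pow intro: divides_trans)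
  moreover have "n * m \<ge> 1" using n b by simp
  ultimately show "x \<in> gd_basic R a"
    using b class_in_gd_basic_iff by blast
qed

lemma gd_basic_self:
  assumes "a \<in> nonzero_nonunits R"
  shows "same_principal R `` {a} \<in> gd_basic R a"
proof -
  have "a divides (a [^] (1::nat))"
    using assms by (simp add: nonzero_nonunits_def)
  then show ?thesis using assms class_in_gd_basic_iff by blast
qed

lemma openin_GD:
  "openin (GD R) = arbitrary union_of (\<lambda>B. B \<in> gd_basic R ` nonzero_nonunits R)"
proof -
  have "istopology (arbitrary union_of (\<lambda>B. B \<in> gd_basic R ` nonzero_nonunits R))"
    unfolding istopology_base_alt
  proof (intro allI impI, elim conjE)
    fix S T
    assume S: "(arbitrary union_of (\<lambda>B. B \<in> gd_basic R ` nonzero_nonunits R)) S"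
      and T: "(arbitrary union_of (\<lambda>B. B \<in> gd_basic R ` nonzero_nonunits R)) T"
    show "(arbitrary union_of (\<lambda>B. B \<in> gd_basic R ` nonzero_nonunits R)) (S \<inter> T)"
      unfolding arbitrary_union_of_alt
    proof
      fix x assume x: "x \<in> S \<inter> T"
      obtain a where a: "a \<in> nonzero_nonunits R" "x \<in> gd_basic R a" "gd_basic R a \<subseteq> S"
        using S x unfolding arbitrary_union_of_alt by blast
      obtain b where b: "b \<in> nonzero_nonunits R" "x \<in> gd_basic R b" "gd_basic R b \<subseteq> T"
        using T x unfolding arbitrary_union_of_alt by blast
      obtain c where c: "c \<in> nonzero_nonunits R" "x = same_principal R `` {c}"
        using a by (auto simp: gd_basic_def)
      have "gd_basic R c \<subseteq> S \<inter> T"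
        using gd_basic_mono a b c by blast
      then show "\<exists>U. U \<in> gd_basic R ` nonzero_nonunits R \<and> x \<in> U \<and> U \<subseteq> S \<inter> T"
        using gd_basic_self c by blast
    qed
  qed
  then show ?thesis by (simp add: GD_def topology_inverse')
qed

lemma topspace_GD: "topspace (GD R) = EC R"
proof -
  have "topspace (GD R) = \<Union>(gd_basic R ` nonzero_nonunits R)"
  proof
    show "topspace (GD R) \<subseteq> \<Union>(gd_basic R ` nonzero_nonunits R)"
      using openin_topspace[of "GD R"] unfolding openin_GD arbitrary_union_of_alt by blast
    have "openin (GD R) (gd_basic R a)" if "a \<in> nonzero_nonunits R" for a
      unfolding openin_GD using that by (intro arbitrary_union_of_inc) blast
    then show "\<Union>(gd_basic R ` nonzero_nonunits R) \<subseteq> topspace (GD R)"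
      using openin_subset by blast
  qed
  also have "\<dots> = EC R"
    using gd_basic_self by (auto simp: EC_def quotient_def gd_basic_def)
  finally show ?thesis .
qed

lemma zariski_closed_Un:
  assumes I: "ideal I R" and J: "ideal J R"
  shows "zariski_closed R I \<union> zariski_closed R J = zariski_closed R (I \<inter> J)"
proof -
  have "I \<subseteq> P \<or> J \<subseteq> P" if P: "primeideal P R" and IJ: "I \<inter> J \<subseteq> P" for P
  proof (rule ccontr)
    assume "\<not> (I \<subseteq> P \<or> J \<subseteq> P)"
    then obtain x y where xy: "x \<in> I" "x \<notin> P" "y \<in> J" "y \<notin> P" by blast
    have carr: "x \<in> carrier R" "y \<in> carrier R"
      using xy ideal.Icarr[OF I] ideal.Icarr[OF J] by blast+
    have "x \<otimes> y \<in> I \<inter> J"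
      using ideal.I_r_closed[OF I] ideal.I_l_closed[OF J] xy carr by blast
    then show False
      using primeideal.I_prime[OF P carr] IJ xy by blast
  qed
  then show ?thesis by (auto simp: zariski_closed_def Spec_def)
qed

lemma zariski_closed_INT:
  assumes "\<And>I. I \<in> \<I> \<Longrightarrow> ideal I R"
  shows "{P \<in> Spec R. \<forall>I\<in>\<I>. I \<subseteq> P} = zariski_closed R (Idl (\<Union>\<I>))"
proof -
  have sub: "\<Union>\<I> \<subseteq> carrier R"
    by (auto dest: assms intro: ideal.Icarr)
  have eq: "Idl (\<Union>\<I>) \<subseteq> P \<longleftrightarrow> \<Union>\<I> \<subseteq> P" if "P \<in> Spec R" for P
  proof -
    have "ideal P R"
      using that by (simp add: Spec_def primeideal.axioms(1))
    then show ?thesis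
      using Idl_subset_ideal sub by blast
  qed
  show ?thesis
    unfolding zariski_closed_def by (rule Collect_cong) (use eq in \<open>simp add: Sup_le_iff cong: conj_cong\<close>)
qed

lemma openin_zariski:
  "openin (zariski R) U \<longleftrightarrow> (\<exists>I. ideal I R \<and> U = Spec R - zariski_closed R I)"
proof -
  have "istopology (\<lambda>U. \<exists>I. ideal I R \<and> U = Spec R - zariski_closed R I)"
    unfolding istopology_def
  proof (intro conjI allI impI)
    fix S T
    assume "\<exists>I. ideal I R \<and> S = Spec R - zariski_closed R I"
      and "\<exists>I. ideal I R \<and> T = Spec R - zariski_closed R I"
    then obtain I J where IJ: "ideal I R" "S = Spec R - zariski_closed R I"
        "ideal J R" "T = Spec R - zariski_closed R J" by blast
    have "S \<inter> T = Spec R - zariski_closed R (I \<inter> J)"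
      unfolding IJ(2,4) zariski_closed_Un[OF IJ(1,3), symmetric] by blast
    then show "\<exists>I. ideal I R \<and> S \<inter> T = Spec R - zariski_closed R I"
      using i_intersect[OF IJ(1,3)] by blast
  next
    fix K
    assume K: "\<forall>S\<in>K. \<exists>I. ideal I R \<and> S = Spec R - zariski_closed R I"
    define \<I> where "\<I> = {I. ideal I R \<and> Spec R - zariski_closed R I \<in> K}"
    have "\<Union>K = (\<Union>I\<in>\<I>. Spec R - zariski_closed R I)"
    proof (intro equalityI Union_least UN_least)
      fix S assume "S \<in> K"
      then obtain I where "ideal I R" "S = Spec R - zariski_closed R I"
        using K by auto
      with \<open>S \<in> K\<close> have "I \<in> \<I>" by (simp add: \<I>_def)
      then show "S \<subseteq> (\<Union>I\<in>\<I>. Spec R - zariski_closed R I)"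
        unfolding \<open>S = Spec R - zariski_closed R I\<close>
        by (intro UN_upper[where B = "\<lambda>I. Spec R - zariski_closed R I"])
    qed (auto simp: \<I>_def simp del: UN_simps intro!: Union_upper)
    also have "\<dots> = Spec R - {P \<in> Spec R. \<forall>I\<in>\<I>. I \<subseteq> P}"
      by (auto simp: zariski_closed_def)
    also have "\<dots> = Spec R - zariski_closed R (Idl (\<Union>\<I>))"
      by (subst zariski_closed_INT) (auto simp: \<I>_def)
    finally have "\<Union>K = Spec R - zariski_closed R (Idl (\<Union>\<I>))" .
    moreover have "\<Union>\<I> \<subseteq> carrier R"
      by (auto simp: \<I>_def intro: ideal.Icarr)
    ultimately show "\<exists>I. ideal I R \<and> \<Union>K = Spec R - zariski_closed R I"
      by (intro exI[of _ "Idl (\<Union>\<I>)"] conjI genideal_ideal)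
  qed
  then show ?thesis by (simp add: zariski_def topology_inverse')
qed

lemma topspace_zariski: "topspace (zariski R) = Spec R"
proof -
  have "zariski_closed R (carrier R) = {}"
  proof -
    have "\<not> carrier R \<subseteq> P" if "primeideal P R" for P
      using primeideal.I_notcarr[OF that] ideal.Icarr[OF primeideal.axioms(1)[OF that]] by auto
    then show ?thesis by (simp add: zariski_closed_def Spec_def)
  qed
  then have "openin (zariski R) (Spec R)"
    unfolding openin_zariski by (intro exI[of _ "carrier R"]) (simp add: oneideal)
  moreover have "topspace (zariski R) \<subseteq> Spec R"
    using openin_topspace[of "zariski R"] unfolding openin_zariski by auto
  ultimately show ?thesis
    by (simp add: openin_subset subset_antisym)
qed

end

end

theory Submission
  imports Defs
begin

text \<open>
  All six statements say that any two elements \<open>a\<close>, \<open>b\<close> of \<open>R\<close> are comparable in the preorder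
  ``\<open>a\<close> divides a power of \<open>b\<close>''. Units and zero are comparable to everything, so it is enough
  to compare nonzero nonunits. For these the preorder is inclusion of basic open sets of
  \<open>GD R\<close> (\<open>gd_basic_subset_iff\<close>) and, reversed, inclusion of radicals of principal ideals
  (\<open>radical_principal_subset_iff\<close>). Since a space is nested as soon as some base
  of it is a chain (\<open>nested_space_iff_base_chain\<close>), this settles the first two statements.

  If elements are comparable in this way, so are radical ideals: given \<open>a\<close> in \<open>I\<close> but not in \<open>J\<close>,
  no \<open>b\<close> in \<open>J\<close> can divide a power of \<open>a\<close>, so \<open>a\<close> divides a power of each \<open>b\<close> in \<open>J\<close>, which puts
  \<open>b\<close> into \<open>I\<close>. In particular the prime ideals then form a chain. The way back from prime ideals to
  elements is Krull's theorem that a prime ideal containing \<open>I\<close> can be chosen to miss any given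
  element outside the radical of \<open>I\<close> (\<open>exists_prime_avoiding\<close>): if neither of \<open>a\<close>, \<open>b\<close> divided a
  power of the other, there would be a prime with \<open>a\<close> and without \<open>b\<close>, and another one with \<open>b\<close>
  and without \<open>a\<close>.

  For quasi-primary ideals: if \<open>a \<otimes> b\<close> lies in \<open>\<surd>I\<close> and \<open>a\<close> divides \<open>b\<^sup>n\<close>, then
  \<open>b\<^bsup>n+1\<^esup>\<close> is a multiple of \<open>a \<otimes> b\<close> and \<open>b\<close> lies in \<open>\<surd>I\<close>; conversely, the radical of \<open>P \<inter> Q\<close>,
  for primes \<open>P\<close> and \<open>Q\<close>, is \<open>P \<inter> Q\<close> itself, and this is prime only if \<open>P\<close> and \<open>Q\<close> are comparable.
  For the Zariski topology, the set of primes above a prime \<open>P\<close> determines \<open>P\<close> as its least element.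
\<close>

section \<open>Nested spaces\<close>

text \<open>If an open set \<open>S\<close> is not contained in \<open>T\<close>, then a basic set \<open>B \<subseteq> S\<close> is not contained in \<open>T\<close>
  either. So \<open>B\<close> lies in no basic subset of \<open>T\<close>, hence contains all of them.\<close>

lemma nested_space_iff_base_chain:
  assumes base: "openin X = arbitrary union_of (\<lambda>B. B \<in> \<B>)"
  shows "nested_space X \<longleftrightarrow> chain\<^sub>\<subseteq> \<B>"
proof
  have "openin X B" if "B \<in> \<B>" for B
    unfolding base using that by (rule arbitrary_union_of_inc)
  then show "chain\<^sub>\<subseteq> \<B>" if "nested_space X"
    using that by (simp add: nested_space_def chain_subset_def)
next
  assume chain: "chain\<^sub>\<subseteq> \<B>"
  have "S \<subseteq> T \<or> T \<subseteq> S" if "openin X S" "openin X T" for S T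
  proof (rule disjCI)
    assume "\<not> T \<subseteq> S"
    then obtain x B where B: "x \<in> B" "x \<notin> S" "B \<in> \<B>" "B \<subseteq> T"
      using \<open>openin X T\<close> unfolding base arbitrary_union_of_alt by blast
    show "S \<subseteq> T"
    proof
      fix y assume "y \<in> S"
      then obtain C where C: "y \<in> C" "C \<in> \<B>" "C \<subseteq> S"
        using \<open>openin X S\<close> unfolding base arbitrary_union_of_alt by blast
      then have "C \<subseteq> B"
        using chain B unfolding chain_subset_def by blast
      then show "y \<in> T" using B C by blast
    qed
  qed
  then show "nested_space X"
    by (simp add: nested_space_def chain_subset_def)
qed

context cring
begin

section \<open>Radicals\<close>

lemma subset_ideal_radical:
  assumes "ideal I R"
  shows "I \<subseteq> ideal_radical R I"
proof
  fix x assume "x \<in> I"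
  then have "x \<in> carrier R" "x [^] (1::nat) \<in> I"
    using ideal.Icarr[OF assms] by auto
  then show "x \<in> ideal_radical R I"
    unfolding ideal_radical_def by blast
qed

lemma ideal_radical_prime:
  assumes "primeideal P R"
  shows "ideal_radical R P = P"
proof
  interpret P: primeideal P R by fact
  have "x \<in> P" if "x \<in> carrier R" "x [^] n \<in> P" "n \<ge> 1" for x and n :: nat
    using that(3,1,2)
  proof (induction n rule: dec_induct)
    case (step n)
    then show ?case using P.I_prime[of "x [^] n" x] by auto
  qed auto
  then show "ideal_radical R P \<subseteq> P"
    unfolding ideal_radical_def by blast
qed (simp add: assms primeideal.axioms(1) subset_ideal_radical)

lemma ideal_radical_mono: "I \<subseteq> J \<Longrightarrow> ideal_radical R I \<subseteq> ideal_radical R J"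
  unfolding ideal_radical_def by blast

lemma divides_in_ideal:
  assumes "ideal I R" "a \<in> I" "a divides b"
  shows "b \<in> I"
  using assms ideal.I_r_closed[OF assms(1)] by (auto simp: factor_def)

lemma mem_principal_iff_divides:
  assumes "a \<in> carrier R"
  shows "x \<in> PIdl a \<longleftrightarrow> a divides x"
  using assms by (auto simp: cgenideal_def factor_def m_comm)

lemma mem_radical_principal_iff:
  assumes "a \<in> carrier R" "b \<in> carrier R"
  shows "b \<in> ideal_radical R (PIdl a) \<longleftrightarrow> (\<exists>n::nat. n \<ge> 1 \<and> a divides (b [^] n))"
  using assms by (simp add: ideal_radical_def mem_principal_iff_divides)

text \<open>Membership of \<open>a\<close> in the larger radical already gives the inclusion, because ``divides a
  power of'' is a transitive relation.\<close>

lemma radical_principal_subset_iff: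
  assumes a: "a \<in> carrier R" and b: "b \<in> carrier R"
  shows "ideal_radical R (PIdl a) \<subseteq> ideal_radical R (PIdl b) \<longleftrightarrow>
    (\<exists>n::nat. n \<ge> 1 \<and> b divides (a [^] n))"
proof
  assume sub: "ideal_radical R (PIdl a) \<subseteq> ideal_radical R (PIdl b)"
  have "a \<in> ideal_radical R (PIdl a)"
    using subset_ideal_radical[OF cgenideal_ideal[OF a]] cgenideal_self[OF a] by blast
  then show "\<exists>n::nat. n \<ge> 1 \<and> b divides (a [^] n)"
    using sub mem_radical_principal_iff[OF b a] by blast
next
  assume "\<exists>n::nat. n \<ge> 1 \<and> b divides (a [^] n)"
  then obtain n :: nat where n: "n \<ge> 1" "b divides (a [^] n)" by blast
  show "ideal_radical R (PIdl a) \<subseteq> ideal_radical R (PIdl b)"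
  proof
    fix x assume x: "x \<in> ideal_radical R (PIdl a)"
    then have xc: "x \<in> carrier R" by (simp add: ideal_radical_def)
    then obtain m :: nat where m: "m \<ge> 1" "a divides (x [^] m)"
      using x a mem_radical_principal_iff by blast
    have "(a [^] n) divides ((x [^] m) [^] n)"
      using m a xc by (simp add: divides_pow)
    then have "b divides (x [^] (m * n))"
      using n a b xc by (auto simp: nat_pow_pow intro: divides_trans)
    moreover have "m * n \<ge> 1" using m n by simp
    ultimately show "x \<in> ideal_radical R (PIdl b)"
      using mem_radical_principal_iff[OF b xc] by blast
  qed
qed


section \<open>Prime ideals avoiding the powers of an element\<close>

lemma ideal_colon:
  assumes "ideal I R" "c \<in> carrier R"
  shows "ideal {x \<in> carrier R. x \<otimes> c \<in> I} R"
proof -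
  interpret I: ideal I R by fact
  show ?thesis
  proof (rule idealI)
    show "subgroup {x \<in> carrier R. x \<otimes> c \<in> I} (add_monoid R)"
    proof (rule add.subgroupI)
      show "{x \<in> carrier R. x \<otimes> c \<in> I} \<noteq> {}"
        using assms by (auto intro: exI[of _ \<zero>])
    qed (use assms in \<open>auto simp: l_distr l_minus\<close>)
    fix a x assume ax: "a \<in> {x \<in> carrier R. x \<otimes> c \<in> I}" "x \<in> carrier R"
    then show "x \<otimes> a \<in> {x \<in> carrier R. x \<otimes> c \<in> I}"
      using assms by (auto simp: m_assoc I.I_l_closed)
    then show "a \<otimes> x \<in> {x \<in> carrier R. x \<otimes> c \<in> I}"
      using ax by (simp add: m_comm)
  qed (rule ring_axioms)
qed

text \<open>Krull's theorem. An ideal \<open>M\<close> that is maximal among those containing \<open>I\<close> and no power of \<open>s\<close>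
  is prime: if \<open>x \<otimes> y \<in> M\<close> with both factors outside \<open>M\<close>, then \<open>x\<close> makes the colon ideal \<open>(M : y)\<close>
  larger than \<open>M\<close>, so it contains some power \<open>s\<^sup>n\<close>; now \<open>y\<close> makes \<open>(M : s\<^sup>n)\<close> larger than \<open>M\<close>, so
  it contains a power of \<open>s\<close> too, and multiplying the two powers gives one in \<open>M\<close>.\<close>

lemma exists_prime_avoiding:
  assumes I: "ideal I R" and s: "s \<in> carrier R" "s \<notin> ideal_radical R I"
  obtains P where "primeideal P R" "I \<subseteq> P" "s \<notin> P"
proof -
  define A where "A = {J. ideal J R \<and> I \<subseteq> J \<and> (\<forall>n::nat. n \<ge> 1 \<longrightarrow> s [^] n \<notin> J)}"
  have "I \<in> A"
    using I s unfolding A_def ideal_radical_def by blast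
  have "\<Union>C \<in> A" if "C \<noteq> {}" "subset.chain A C" for C
  proof -
    have "C \<subseteq> A" using that(2) by (simp add: pred_on.chain_def)
    moreover have "subset.chain {I. ideal I R} C"
      using that(2) by (auto simp: pred_on.chain_def A_def)
    then have "ideal (\<Union>C) R"
      using chain_Union_is_ideal[of C] that(1) by simp
    ultimately show ?thesis
      using that(1) unfolding A_def by blast
  qed
  then obtain M where M: "M \<in> A" and max: "\<And>J. J \<in> A \<Longrightarrow> M \<subseteq> J \<Longrightarrow> J = M"
    using subset_Zorn_nonempty[of A] \<open>I \<in> A\<close> by blast
  interpret M: ideal M R using M by (simp add: A_def)
  have IM: "I \<subseteq> M" and avoid: "\<And>n::nat. n \<ge> 1 \<Longrightarrow> s [^] n \<notin> M"
    using M by (auto simp: A_def)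
  have colon: "\<exists>n::nat. n \<ge> 1 \<and> s [^] n \<otimes> c \<in> M"
    if "c \<in> carrier R" "x \<in> carrier R" "x \<otimes> c \<in> M" "x \<notin> M" for c x
  proof (rule ccontr)
    assume "\<nexists>n::nat. n \<ge> 1 \<and> s [^] n \<otimes> c \<in> M"
    moreover have "M \<subseteq> {x \<in> carrier R. x \<otimes> c \<in> M}"
      using that by (auto simp: M.I_r_closed)
    ultimately have "{x \<in> carrier R. x \<otimes> c \<in> M} \<in> A"
      using ideal_colon[OF M.is_ideal that(1)] IM unfolding A_def by blast
    then show False
      using max \<open>M \<subseteq> _\<close> that by blast
  qed
  have "primeideal M R"
  proof (rule primeidealI)
    show "carrier R \<noteq> M"
      using avoid[of 1] s by auto
    fix x y assume xy: "x \<in> carrier R" "y \<in> carrier R" "x \<otimes> y \<in> M"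
    show "x \<in> M \<or> y \<in> M"
    proof (rule ccontr)
      assume neither: "\<not> (x \<in> M \<or> y \<in> M)"
      obtain n :: nat where n: "n \<ge> 1" "s [^] n \<otimes> y \<in> M"
        using colon[of y x] xy neither by blast
      then have "y \<otimes> s [^] n \<in> M"
        using s xy by (simp add: m_comm)
      then obtain m :: nat where m: "m \<ge> 1" "s [^] m \<otimes> s [^] n \<in> M"
        using colon[of "s [^] n" y] s xy neither by blast
      then show False
        using avoid[of "m + n"] s by (simp add: nat_pow_mult)
    qed
  qed (rule M.is_ideal cring_axioms)+
  moreover have "s \<notin> M"
    using avoid[of 1] s by simp
  ultimately show thesis
    using that IM by blast
qed

text \<open>The radical is the intersection of the primes above \<open>I\<close>, so it inherits the closure
  properties of an ideal from them.\<close>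

lemma ideal_radical_eq_Inter:
  assumes "ideal I R"
  shows "ideal_radical R I = {x \<in> carrier R. \<forall>P. primeideal P R \<and> I \<subseteq> P \<longrightarrow> x \<in> P}"
proof
  show "ideal_radical R I \<subseteq> {x \<in> carrier R. \<forall>P. primeideal P R \<and> I \<subseteq> P \<longrightarrow> x \<in> P}"
    using ideal_radical_mono[of I] ideal_radical_prime by (auto simp: ideal_radical_def) blast
  show "{x \<in> carrier R. \<forall>P. primeideal P R \<and> I \<subseteq> P \<longrightarrow> x \<in> P} \<subseteq> ideal_radical R I"
    using exists_prime_avoiding[OF assms] by blast
qed

lemma ideal_ideal_radical:
  assumes "ideal I R"
  shows "ideal (ideal_radical R I) R"
proof -
  have *: "ideal P R" if "primeideal P R" for P
    using that by (rule primeideal.axioms(1))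
  show ?thesis
    unfolding ideal_radical_eq_Inter[OF assms]
  proof (rule idealI)
    show "subgroup {x \<in> carrier R. \<forall>P. primeideal P R \<and> I \<subseteq> P \<longrightarrow> x \<in> P} (add_monoid R)"
    proof (rule add.subgroupI)
      show "{x \<in> carrier R. \<forall>P. primeideal P R \<and> I \<subseteq> P \<longrightarrow> x \<in> P} \<noteq> {}"
        using * by (blast intro: zero_closed additive_subgroup.zero_closed ideal.axioms(1))
    qed (use * oneideal in \<open>auto intro!: additive_subgroup.a_closed additive_subgroup.a_inv_closed
          ideal.axioms(1)\<close>)
  qed (use * oneideal in \<open>auto simp: ring_axioms intro: ideal.I_l_closed ideal.I_r_closed\<close>)
qed


section \<open>Comparability of elements up to powers\<close>

text \<open>The set \<open>A\<close> is a parameter because the divisor topology and the principal radicals only see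
  the nonzero nonunits, whereas the arguments with ideals involve arbitrary elements.\<close>

definition comparable_up_to_powers :: "'a set \<Rightarrow> bool" where
  "comparable_up_to_powers A \<longleftrightarrow> (\<forall>a\<in>A. \<forall>b\<in>A.
     (\<exists>n::nat. n \<ge> 1 \<and> a divides (b [^] n)) \<or> (\<exists>n::nat. n \<ge> 1 \<and> b divides (a [^] n)))"

text \<open>A unit divides every element, and every element divides zero.\<close>

lemma comparable_nonzero_nonunits_iff:
  "comparable_up_to_powers (nonzero_nonunits R) \<longleftrightarrow> comparable_up_to_powers (carrier R)"
proof
  assume cmp: "comparable_up_to_powers (nonzero_nonunits R)"
  have unit: "\<exists>n::nat. n \<ge> 1 \<and> u divides (x [^] n)"
    if "u \<in> Units R" "x \<in> carrier R" for u x
    using that by (intro exI[of _ 1]) (simp add: unit_divides)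
  have zero: "\<exists>n::nat. n \<ge> 1 \<and> x divides (\<zero> [^] n)" if "x \<in> carrier R" for x
    using that by (intro exI[of _ 1]) (auto simp: factor_def intro!: bexI[of _ \<zero>])
  show "comparable_up_to_powers (carrier R)"
    unfolding comparable_up_to_powers_def
  proof (intro ballI)
    fix a b assume ab: "a \<in> carrier R" "b \<in> carrier R"
    consider "a \<in> nonzero_nonunits R" "b \<in> nonzero_nonunits R"
      | "a \<in> Units R" | "b \<in> Units R" | "a = \<zero>" | "b = \<zero>"
      using ab by (auto simp: nonzero_nonunits_def)
    then show "(\<exists>n::nat. n \<ge> 1 \<and> a divides (b [^] n)) \<or> (\<exists>n::nat. n \<ge> 1 \<and> b divides (a [^] n))"
      by cases (use cmp ab unit zero in \<open>auto simp: comparable_up_to_powers_def\<close>)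
  qed
qed (auto simp: comparable_up_to_powers_def nonzero_nonunits_def)

lemma chain_principal_radicals_iff:
  "chain\<^sub>\<subseteq> (principal_radicals R) \<longleftrightarrow> comparable_up_to_powers (carrier R)"
proof -
  have carr: "a \<in> carrier R" if "a \<in> nonzero_nonunits R" for a
    using that by (simp add: nonzero_nonunits_def)
  have "principal_radicals R = (\<lambda>a. ideal_radical R (PIdl a)) ` nonzero_nonunits R"
    by (auto simp: principal_radicals_def)
  then have "chain\<^sub>\<subseteq> (principal_radicals R) \<longleftrightarrow> comparable_up_to_powers (nonzero_nonunits R)"
    by (auto simp: chain_subset_def comparable_up_to_powers_def radical_principal_subset_iff carr)
  then show ?thesis
    by (simp add: comparable_nonzero_nonunits_iff)
qed

lemma gd_basic_subset_iff:
  assumes "a \<in> nonzero_nonunits R" "b \<in> nonzero_nonunits R"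
  shows "gd_basic R a \<subseteq> gd_basic R b \<longleftrightarrow> (\<exists>n::nat. n \<ge> 1 \<and> a divides (b [^] n))"
  using assms gd_basic_mono gd_basic_self class_in_gd_basic_iff by blast

lemma nested_GD_iff: "nested_space (GD R) \<longleftrightarrow> comparable_up_to_powers (carrier R)"
proof -
  have "nested_space (GD R) \<longleftrightarrow> chain\<^sub>\<subseteq> (gd_basic R ` nonzero_nonunits R)"
    by (rule nested_space_iff_base_chain[OF openin_GD])
  also have "\<dots> \<longleftrightarrow> comparable_up_to_powers (nonzero_nonunits R)"
    by (auto simp: chain_subset_def comparable_up_to_powers_def gd_basic_subset_iff)
  finally show ?thesis
    by (simp add: comparable_nonzero_nonunits_iff)
qed

lemma comparable_imp_chain_radical_ideals:
  assumes cmp: "comparable_up_to_powers (carrier R)"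
  shows "chain\<^sub>\<subseteq> {I. radical_ideal I R}"
proof -
  have "I \<subseteq> J \<or> J \<subseteq> I" if I: "radical_ideal I R" and J: "radical_ideal J R" for I J
  proof (rule disjCI)
    assume "\<not> J \<subseteq> I"
    then obtain b where b: "b \<in> J" "b \<notin> I" by blast
    have idI: "ideal I R" and idJ: "ideal J R"
      using I J by (auto simp: radical_ideal_def)
    have radI: "ideal_radical R I = I" and radJ: "ideal_radical R J = J"
      using I J by (auto simp: radical_ideal_def)
    have bc: "b \<in> carrier R" using ideal.Icarr[OF idJ b(1)] .
    show "I \<subseteq> J"
    proof
      fix a assume a: "a \<in> I"
      then have ac: "a \<in> carrier R" by (rule ideal.Icarr[OF idI])
      have "\<not> a divides (b [^] n)" if "n \<ge> 1" for n :: nat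
      proof
        assume "a divides (b [^] n)"
        then have "b \<in> ideal_radical R I"
          using divides_in_ideal[OF idI a] bc that by (auto simp: ideal_radical_def)
        then show False using radI b by simp
      qed
      then obtain n :: nat where "n \<ge> 1" "b divides (a [^] n)"
        using cmp ac bc unfolding comparable_up_to_powers_def by blast
      then have "a \<in> ideal_radical R J"
        using divides_in_ideal[OF idJ b(1)] ac by (auto simp: ideal_radical_def)
      then show "a \<in> J" using radJ by simp
    qed
  qed
  then show ?thesis by (simp add: chain_subset_def)
qed

lemma chain_radical_imp_chain_prime:
  assumes "chain\<^sub>\<subseteq> {I. radical_ideal I R}"
  shows "chain\<^sub>\<subseteq> {P. primeideal P R}"
proof -
  have "radical_ideal P R" if "primeideal P R" for P
    using that by (simp add: radical_ideal_def ideal_radical_prime primeideal.axioms(1))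
  then show ?thesis
    using assms by (simp add: chain_subset_def)
qed

lemma chain_prime_imp_comparable:
  assumes chain: "chain\<^sub>\<subseteq> {P. primeideal P R}"
  shows "comparable_up_to_powers (carrier R)"
  unfolding comparable_up_to_powers_def
proof (intro ballI, rule ccontr)
  fix a b assume ab: "a \<in> carrier R" "b \<in> carrier R"
  assume "\<not> ((\<exists>n::nat. n \<ge> 1 \<and> a divides (b [^] n)) \<or> (\<exists>n::nat. n \<ge> 1 \<and> b divides (a [^] n)))"
  then have "b \<notin> ideal_radical R (PIdl a)" "a \<notin> ideal_radical R (PIdl b)"
    using ab mem_radical_principal_iff by blast+
  then obtain P Q where "primeideal P R" "PIdl a \<subseteq> P" "b \<notin> P"
    and "primeideal Q R" "PIdl b \<subseteq> Q" "a \<notin> Q"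
    using exists_prime_avoiding cgenideal_ideal ab by metis
  moreover have "a \<in> PIdl a" "b \<in> PIdl b"
    using ab by (simp_all add: cgenideal_self)
  ultimately show False
    using chain unfolding chain_subset_def by blast
qed

lemma chain_radical_ideals_iff:
  "chain\<^sub>\<subseteq> {I. radical_ideal I R} \<longleftrightarrow> comparable_up_to_powers (carrier R)"
  using comparable_imp_chain_radical_ideals chain_radical_imp_chain_prime
    chain_prime_imp_comparable by blast

lemma chain_prime_ideals_iff:
  "chain\<^sub>\<subseteq> {P. primeideal P R} \<longleftrightarrow> comparable_up_to_powers (carrier R)"
  using comparable_imp_chain_radical_ideals chain_radical_imp_chain_prime
    chain_prime_imp_comparable by blast


section \<open>Quasi-primary ideals and the Zariski topology\<close>

lemma comparable_imp_quasi_primary: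
  assumes cmp: "comparable_up_to_powers (carrier R)" and I: "ideal I R" "I \<noteq> carrier R"
  shows "quasi_primary I R"
proof -
  have prod: "y \<in> ideal_radical R I"
    if xy: "x \<in> carrier R" "y \<in> carrier R" "x \<otimes> y \<in> ideal_radical R I" "x divides (y [^] n)"
    for x y and n :: nat
  proof -
    obtain z where z: "z \<in> carrier R" "y [^] n = x \<otimes> z"
      using xy(4) unfolding factor_def by blast
    obtain m :: nat where m: "m \<ge> 1" "(x \<otimes> y) [^] m \<in> I"
      using xy by (auto simp: ideal_radical_def)
    have "y [^] Suc n = (x \<otimes> y) \<otimes> z"
      using z xy by (simp add: m_ac)
    then have "(x \<otimes> y) divides (y [^] Suc n)"
      using z by (auto simp: factor_def)
    then have "((x \<otimes> y) [^] m) divides ((y [^] Suc n) [^] m)"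
      using xy by (intro divides_pow) auto
    then have "y [^] (Suc n * m) \<in> I"
      using divides_in_ideal[OF I(1) m(2)] xy by (metis nat_pow_pow)
    moreover have "Suc n * m \<ge> 1" using m by simp
    ultimately show ?thesis
      using xy unfolding ideal_radical_def by blast
  qed
  have "primeideal (ideal_radical R I) R"
  proof (rule primeidealI)
    show "carrier R \<noteq> ideal_radical R I"
    proof
      assume "carrier R = ideal_radical R I"
      then have "\<one> \<in> ideal_radical R I" by (metis one_closed)
      then have "\<one> \<in> I" by (simp add: ideal_radical_def)
      then show False
        using I ideal.one_imp_carrier by blast
    qed
    fix x y assume xy: "x \<in> carrier R" "y \<in> carrier R" "x \<otimes> y \<in> ideal_radical R I"
    then have "y \<otimes> x \<in> ideal_radical R I" by (simp add: m_comm)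
    then show "x \<in> ideal_radical R I \<or> y \<in> ideal_radical R I"
      using prod xy cmp unfolding comparable_up_to_powers_def by blast
  qed (use I cring_axioms in \<open>auto simp: ideal_ideal_radical\<close>)
  then show ?thesis
    using I by (simp add: quasi_primary_def)
qed

text \<open>Apply the hypothesis to \<open>P \<inter> Q\<close>. For \<open>x \<in> P - Q\<close> and \<open>y \<in> Q - P\<close> the product lies in
  \<open>P \<inter> Q\<close>, but neither factor lies in its radical.\<close>

lemma quasi_primary_imp_chain_prime:
  assumes qp: "\<And>I. ideal I R \<Longrightarrow> I \<noteq> carrier R \<Longrightarrow> quasi_primary I R"
  shows "chain\<^sub>\<subseteq> {P. primeideal P R}"
proof -
  have "P \<subseteq> Q \<or> Q \<subseteq> P" if P: "primeideal P R" and Q: "primeideal Q R" for P Q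
  proof (rule ccontr)
    assume "\<not> (P \<subseteq> Q \<or> Q \<subseteq> P)"
    then obtain x y where xy: "x \<in> P" "x \<notin> Q" "y \<in> Q" "y \<notin> P" by blast
    interpret P: primeideal P R by fact
    interpret Q: primeideal Q R by fact
    have carr: "x \<in> carrier R" "y \<in> carrier R"
      using xy P.Icarr Q.Icarr by blast+
    have PQ: "ideal (P \<inter> Q) R" "P \<inter> Q \<noteq> carrier R"
      using i_intersect[OF P.is_ideal Q.is_ideal] xy carr by blast+
    then have "primeideal (ideal_radical R (P \<inter> Q)) R"
      using qp unfolding quasi_primary_def by blast
    moreover have "x \<otimes> y \<in> P \<inter> Q"
      using xy carr by (simp add: P.I_r_closed Q.I_l_closed)
    then have "x \<otimes> y \<in> ideal_radical R (P \<inter> Q)"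
      using subset_ideal_radical[OF PQ(1)] by blast
    ultimately have "x \<in> ideal_radical R (P \<inter> Q) \<or> y \<in> ideal_radical R (P \<inter> Q)"
      using primeideal.I_prime[OF _ carr] by blast
    moreover have "ideal_radical R (P \<inter> Q) \<subseteq> P \<inter> Q"
      using ideal_radical_mono[of "P \<inter> Q" P] ideal_radical_mono[of "P \<inter> Q" Q]
      by (simp add: ideal_radical_prime P Q)
    ultimately show False using xy by blast
  qed
  then show ?thesis by (simp add: chain_subset_def)
qed

lemma all_quasi_primary_iff:
  "(\<forall>I. ideal I R \<and> I \<noteq> carrier R \<longrightarrow> quasi_primary I R) \<longleftrightarrow>
     comparable_up_to_powers (carrier R)"
  using comparable_imp_quasi_primary quasi_primary_imp_chain_prime chain_prime_imp_comparable
  by blast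

lemma nested_zariski_iff_closed:
  "nested_space (zariski R) \<longleftrightarrow> chain\<^sub>\<subseteq> (zariski_closed R ` {I. ideal I R})"
proof -
  have "zariski_closed R I \<subseteq> Spec R" for I
    by (auto simp: zariski_closed_def)
  then have "Spec R - zariski_closed R I \<subseteq> Spec R - zariski_closed R J \<longleftrightarrow>
      zariski_closed R J \<subseteq> zariski_closed R I" for I J
    by blast
  moreover have "{U. openin (zariski R) U} =
      (\<lambda>I. Spec R - zariski_closed R I) ` {I. ideal I R}"
    by (auto simp: openin_zariski)
  ultimately show ?thesis
    by (simp add: nested_space_def chain_subset_def) blast
qed

text \<open>When the primes form a chain, the closed sets are upward closed subsets of a chain, and any
  two of those are comparable. Conversely, a prime \<open>P\<close> is the least member of the closed set that
  it defines, so comparable closed sets have comparable least members.\<close>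

lemma nested_zariski_iff_chain_prime:
  "nested_space (zariski R) \<longleftrightarrow> chain\<^sub>\<subseteq> {P. primeideal P R}"
  unfolding nested_zariski_iff_closed
proof
  assume chain: "chain\<^sub>\<subseteq> (zariski_closed R ` {I. ideal I R})"
  have "P \<subseteq> Q \<or> Q \<subseteq> P" if P: "primeideal P R" and Q: "primeideal Q R" for P Q
  proof -
    have "P \<in> zariski_closed R P" "Q \<in> zariski_closed R Q"
      using P Q by (auto simp: zariski_closed_def Spec_def)
    moreover have "zariski_closed R P \<subseteq> zariski_closed R Q \<or>
        zariski_closed R Q \<subseteq> zariski_closed R P"
      using chain primeideal.axioms(1)[OF P] primeideal.axioms(1)[OF Q]
      by (simp add: chain_subset_def)
    ultimately show ?thesis
      unfolding zariski_closed_def by blast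
  qed
  then show "chain\<^sub>\<subseteq> {P. primeideal P R}"
    by (simp add: chain_subset_def)
next
  assume chain: "chain\<^sub>\<subseteq> {P. primeideal P R}"
  have "zariski_closed R I \<subseteq> zariski_closed R J \<or> zariski_closed R J \<subseteq> zariski_closed R I"
    for I J
  proof (rule ccontr)
    assume "\<not> ?thesis"
    then obtain P Q where "primeideal P R" "I \<subseteq> P" "\<not> J \<subseteq> P"
      and "primeideal Q R" "J \<subseteq> Q" "\<not> I \<subseteq> Q"
      by (auto simp: zariski_closed_def Spec_def)
    then show False
      using chain unfolding chain_subset_def by blast
  qed
  then show "chain\<^sub>\<subseteq> (zariski_closed R ` {I. ideal I R})"
    by (auto simp: chain_subset_def)
qed

end


section \<open>The equivalence\<close>

theorem theorem4p1:
  fixes R :: "('a, 'b) ring_scheme" (structure)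
  assumes "cring R" and "\<one> \<noteq> \<zero>"
  shows "(nested_space (GD R) \<longleftrightarrow> chain\<^sub>\<subseteq> (principal_radicals R)) \<and>
         (chain\<^sub>\<subseteq> (principal_radicals R) \<longleftrightarrow> chain\<^sub>\<subseteq> {I. radical_ideal I R}) \<and>
         (chain\<^sub>\<subseteq> {I. radical_ideal I R} \<longleftrightarrow> chain\<^sub>\<subseteq> {P. primeideal P R}) \<and>
         (chain\<^sub>\<subseteq> {P. primeideal P R} \<longleftrightarrow>
            (\<forall>I. ideal I R \<and> I \<noteq> carrier R \<longrightarrow> quasi_primary I R)) \<and>
         ((\<forall>I. ideal I R \<and> I \<noteq> carrier R \<longrightarrow> quasi_primary I R) \<longleftrightarrow>
            nested_space (zariski R))"
proof -
  interpret cring R by fact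
  show ?thesis
    unfolding nested_GD_iff chain_principal_radicals_iff chain_radical_ideals_iff
      all_quasi_primary_iff nested_zariski_iff_chain_prime chain_prime_ideals_iff
    by simp
qed

end
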